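(* Let $T=T_{(\pi,\lambda)}$ be an interval exchange transformation of $[0,1)$ which is minimal and which is not of rotation type. Suppose that the lengths $\lambda_1,\dots,\lambda_m$ of the exchanged subintervals are linearly independent over $\mathbb{Q}$. Then $T$ does not have an $n^{th}$ root in $\mathbb{G}$ for any $n\geq 2$; that is, for every $n\ge 2$ there is no interval exchange transformation $S$ with $T=S^n$.
   Context: Interval exchange transformations (IETs): fix $m\in\mathbb{N}$, $m\ge 1$, a permutation $\pi$ of $\{1,\dots,m\}$, and $\lambda=(\lambda_1,\dots,\lambda_m)$ in $\Delta_m=\{\lambda\in\mathbb{R}^m:\lambda_i>0,\ \sum_i\lambda_i=1\}$. Put $\beta_0=0$, $\beta_j=\lambda_1+\cdots+\lambda_j$, and $I_j=[\beta_{j-1},\beta_j)$ for $1\le j\le m$. The $m$-IET $T_{(\pi,\lambda)}:[0,1)\to[0,1)$ is the bijection given by $T_{(\pi,\lambda)}(x)=x-\sum_{i<j}\lambda_i+\sum_{\pi(i)<\pi(j)}\lambda_i$ for $x\in I_j$. An IET is any map of this form. The set of all IETs forms a group $\mathbb{G}$ under composition, and $S^n$ denotes the $n$-fold composition of $S$. An IET $T$ is minimal if for every $x\in[0,1)$ the orbit $\{T^n(x):n\in\mathbb{Z}\}$ is dense in $[0,1)$. $T$ is of rotation type if there is $\alpha\in\mathbb{R}$ such that $T(x)=x+\alpha \pmod 1$ for all $x\in[0,1)$. $T$ has an $n^{th}$ root in $\mathbb{G}$ if there is $S\in\mathbb{G}$ with $T=S^n$. *)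

theory Defs
  imports "HOL-Analysis.Analysis" "HOL-Combinatorics.Permutations"
begin

definition iet_data :: "nat \<Rightarrow> (nat \<Rightarrow> nat) \<Rightarrow> (nat \<Rightarrow> real) \<Rightarrow> bool" where
  "iet_data m \<pi> len \<longleftrightarrow> 1 \<le> m \<and> \<pi> permutes {1..m} \<and>
     (\<forall>i\<in>{1..m}. 0 < len i) \<and> (\<Sum>i=1..m. len i) = 1"

definition iet_endpoint :: "(nat \<Rightarrow> real) \<Rightarrow> nat \<Rightarrow> real" where
  "iet_endpoint len j = (\<Sum>i=1..j. len i)"

definition iet_interval :: "(nat \<Rightarrow> real) \<Rightarrow> nat \<Rightarrow> real set" where
  "iet_interval len j = {iet_endpoint len (j - 1) ..< iet_endpoint len j}"

text \<open>A map of \<open>[0,1)\<close> is represented by its extension to all reals by the identity, so that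
  equality, composition and inversion of maps of \<open>[0,1)\<close> agree with those of type
  \<^typ>\<open>real \<Rightarrow> real\<close>.  Under \<open>iet_data\<close> the index chosen by \<open>THE\<close> exists
  and is unique (\<open>ex1_iet_interval\<close> below).\<close>

definition iet :: "nat \<Rightarrow> (nat \<Rightarrow> nat) \<Rightarrow> (nat \<Rightarrow> real) \<Rightarrow> real \<Rightarrow> real" where
  "iet m \<pi> len x =
     (if x \<in> {0..<1} then
        let j = (THE j. j \<in> {1..m} \<and> x \<in> iet_interval len j)
        in x - (\<Sum>i\<in>{i\<in>{1..m}. i < j}. len i) + (\<Sum>i\<in>{i\<in>{1..m}. \<pi> i < \<pi> j}. len i)
      else x)"

definition IETs :: "(real \<Rightarrow> real) set" where
  "IETs = {T. \<exists>m \<pi> len. iet_data m \<pi> len \<and> T = iet m \<pi> len}"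

definition full_orbit :: "('a \<Rightarrow> 'a) \<Rightarrow> 'a \<Rightarrow> 'a set" where
  "full_orbit T x = {(T ^^ n) x |n. True} \<union> {(inv T ^^ n) x |n. True}"

definition minimal_iet :: "(real \<Rightarrow> real) \<Rightarrow> bool" where
  "minimal_iet T \<longleftrightarrow> (\<forall>x\<in>{0..<1}. {0..<1} \<subseteq> closure (full_orbit T x))"

definition rotation_type :: "(real \<Rightarrow> real) \<Rightarrow> bool" where
  "rotation_type T \<longleftrightarrow> (\<exists>\<alpha>. \<forall>x\<in>{0..<1}. T x = frac (x + \<alpha>))"

definition has_iet_root :: "nat \<Rightarrow> (real \<Rightarrow> real) \<Rightarrow> bool" where
  "has_iet_root n T \<longleftrightarrow> (\<exists>S\<in>IETs. T = S ^^ n)"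

text \<open>Injectivity makes this linear independence of the family, not merely of its set of
  values.\<close>

definition lin_indep_over_rat :: "('i \<Rightarrow> real) \<Rightarrow> 'i set \<Rightarrow> bool" where
  "lin_indep_over_rat f I \<longleftrightarrow>
     inj_on f I \<and> module.independent (\<lambda>(q::rat) (x::real). of_rat q * x) (f ` I)"

lemma module_rat_real: "module (\<lambda>(q::rat) (x::real). of_rat q * x)"
  by unfold_locales (auto simp: algebra_simps of_rat_add of_rat_mult)

lemma lin_indep_over_rat_iff:
  assumes "finite I"
  shows "lin_indep_over_rat f I \<longleftrightarrow>
    (\<forall>c::'i \<Rightarrow> rat. (\<Sum>i\<in>I. of_rat (c i) * f i) = 0 \<longrightarrow> (\<forall>i\<in>I. c i = 0))" (is "_ \<longleftrightarrow> ?R")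
proof -
  interpret M: module "\<lambda>(q::rat) (x::real). of_rat q * x" by (rule module_rat_real)
  have ind: "M.independent (f ` I) \<longleftrightarrow>
      (\<forall>u. (\<Sum>v\<in>f ` I. of_rat (u v) * v) = 0 \<longrightarrow> (\<forall>v\<in>f ` I. u v = 0))"
    using assms by (auto simp: M.dependent_finite)
  show ?thesis
  proof
    assume L: "lin_indep_over_rat f I"
    then have inj: "inj_on f I" and i: "M.independent (f ` I)"
      by (auto simp: lin_indep_over_rat_def)
    show ?R
    proof (intro allI impI ballI)
      fix c :: "'i \<Rightarrow> rat" and k
      assume c: "(\<Sum>i\<in>I. of_rat (c i) * f i) = 0" and k: "k \<in> I"
      have "(\<Sum>v\<in>f ` I. of_rat (c (the_inv_into I f v)) * v) = 0"
        using c by (subst sum.reindex[OF inj]) (simp add: the_inv_into_f_f[OF inj])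
      with i k have "c (the_inv_into I f (f k)) = 0" unfolding ind
        by (elim allE[where x="\<lambda>v. c (the_inv_into I f v)"]) auto
      then show "c k = 0" using the_inv_into_f_f[OF inj k] by simp
    qed
  next
    assume R: ?R
    have inj: "inj_on f I"
    proof (rule inj_onI, rule ccontr)
      fix a b assume ab: "a \<in> I" "b \<in> I" "f a = f b" "a \<noteq> b"
      let ?c = "\<lambda>i. if i = a then 1 else if i = b then -1 else 0 :: rat"
      have "(\<Sum>i\<in>I. of_rat (?c i) * f i) =
            (\<Sum>i\<in>I. (if i = a then f a else 0) - (if i = b then f b else 0))"
        using ab by (intro sum.cong) (auto simp: of_rat_minus)
      also have "\<dots> = 0" using ab assms by (simp add: sum_subtractf)
      finally have "?c a = 0" using R[rule_format, of ?c a] ab(1) by blast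
      then show False by simp
    qed
    have "M.independent (f ` I)" unfolding ind
    proof (intro allI impI)
      fix u assume "(\<Sum>v\<in>f ` I. of_rat (u v) * v) = 0"
      then have "(\<Sum>i\<in>I. of_rat ((u \<circ> f) i) * f i) = 0"
        by (simp add: sum.reindex[OF inj])
      then show "\<forall>v\<in>f ` I. u v = 0" using R[rule_format, of "u \<circ> f"] by auto
    qed
    with inj show "lin_indep_over_rat f I" by (simp add: lin_indep_over_rat_def)
  qed
qed

lemma ex1_iet_interval:
  assumes pos: "\<forall>i\<in>{1..m}. 0 < len i" and tot: "(\<Sum>i=1..m. len i) = 1" and x: "x \<in> {0..<1}"
  shows "\<exists>!j. j \<in> {1..m} \<and> x \<in> iet_interval len j"
proof (rule ex_ex1I)
  define j where "j = (LEAST j. x < iet_endpoint len j)"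
  have m: "x < iet_endpoint len m" using x tot by (simp add: iet_endpoint_def)
  have j: "x < iet_endpoint len j" "j \<le> m"
    unfolding j_def using m by (auto intro: LeastI Least_le)
  have j0: "j \<noteq> 0"
  proof
    assume "j = 0"
    with j x show False by (simp add: iet_endpoint_def)
  qed
  have "\<not> x < iet_endpoint len (j - 1)"
    using not_less_Least[of "j - 1" "\<lambda>j. x < iet_endpoint len j"] j0 unfolding j_def by simp
  with j j0 show "\<exists>j. j \<in> {1..m} \<and> x \<in> iet_interval len j"
    by (intro exI[of _ j]) (auto simp: iet_interval_def)
next
  have mono: "iet_endpoint len a \<le> iet_endpoint len b" if "a \<le> b" "b \<le> m" for a b
    unfolding iet_endpoint_def using that pos by (intro sum_mono2) (auto intro: less_imp_le)
  have no: False if "a < b" "a \<in> {1..m}" "b \<in> {1..m}" "x \<in> iet_interval len a"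
      "x \<in> iet_interval len b" for a b
  proof -
    have "a \<le> b - 1" "b - 1 \<le> m" using that by auto
    from mono[OF this] show False using that by (auto simp: iet_interval_def)
  qed
  fix a b
  assume "a \<in> {1..m} \<and> x \<in> iet_interval len a" "b \<in> {1..m} \<and> x \<in> iet_interval len b"
  then show "a = b" using no[of a b] no[of b a] by (cases a b rule: linorder_cases) auto
qed

lemma iet_eq:
  assumes d: "iet_data m \<pi> len" and x: "x \<in> {0..<1}"
    and j: "j \<in> {1..m}" "x \<in> iet_interval len j"
  shows "iet m \<pi> len x =
    x - iet_endpoint len (j - 1) + (\<Sum>i\<in>{i\<in>{1..m}. \<pi> i < \<pi> j}. len i)"
proof -
  have e: "(THE j. j \<in> {1..m} \<and> x \<in> iet_interval len j) = j"
    using ex1_iet_interval[of m len x] d x j by (intro the1_equality) (auto simp: iet_data_def)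
  have "{i\<in>{1..m}. i < j} = {1..j - 1}" using j by auto
  then show ?thesis using x e by (simp add: iet_def iet_endpoint_def)
qed

lemma iet_data_inv:
  assumes d: "iet_data m \<pi> len"
  shows "iet_data m (inv \<pi>) (len \<circ> inv \<pi>)"
proof -
  have p: "\<pi> permutes {1..m}" using d by (simp add: iet_data_def)
  have q: "inv \<pi> permutes {1..m}" by (rule permutes_inv[OF p])
  have "(\<Sum>i=1..m. (len \<circ> inv \<pi>) i) = (\<Sum>i=1..m. len i)"
    by (rule sum.permute[OF q, symmetric])
  moreover have "\<forall>i\<in>{1..m}. inv \<pi> i \<in> {1..m}" using permutes_in_image[OF q] by blast
  ultimately show ?thesis using d q by (auto simp: iet_data_def)
qed

text \<open>The inverse of an interval exchange is the exchange of the image intervals.\<close>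

lemma iet_inverse:
  assumes d: "iet_data m \<pi> len" and x: "x \<in> {0..<1}"
  shows "iet m \<pi> len x \<in> {0..<1}" and "iet m (inv \<pi>) (len \<circ> inv \<pi>) (iet m \<pi> len x) = x"
proof -
  let ?\<mu> = "len \<circ> inv \<pi>"
  have p: "\<pi> permutes {1..m}" and pos: "\<forall>i\<in>{1..m}. 0 < len i"
    and tot: "(\<Sum>i=1..m. len i) = 1" using d by (auto simp: iet_data_def)
  have d': "iet_data m (inv \<pi>) ?\<mu>" by (rule iet_data_inv[OF d])
  obtain j where j: "j \<in> {1..m}" "x \<in> iet_interval len j"
    using ex1_iet_interval[OF pos tot x] by blast
  have pj: "\<pi> j \<in> {1..m}" using permutes_in_image[OF p] j by blast
  have invp: "inv \<pi> (\<pi> i) = i" "\<pi> (inv \<pi> i) = i" for i using permutes_inverses[OF p] by auto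
  have injp: "inj_on \<pi> A" for A using permutes_inj[OF p] by (rule inj_on_subset) simp
  have im: "\<pi> ` {i\<in>{1..m}. \<pi> i < \<pi> j} = {1..\<pi> j - 1}"
  proof (intro equalityI subsetI)
    fix k assume "k \<in> \<pi> ` {i\<in>{1..m}. \<pi> i < \<pi> j}"
    then obtain i where i: "i \<in> {1..m}" "k = \<pi> i" "\<pi> i < \<pi> j" by auto
    then have "\<pi> i \<in> {1..m}" using permutes_in_image[OF p] by blast
    with i show "k \<in> {1..\<pi> j - 1}" by auto
  next
    fix k assume k: "k \<in> {1..\<pi> j - 1}"
    then have "k \<in> {1..m}" using pj by auto
    then have "inv \<pi> k \<in> {1..m}" using permutes_in_image[OF permutes_inv[OF p]] by blast
    with k show "k \<in> \<pi> ` {i\<in>{1..m}. \<pi> i < \<pi> j}"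
      by (intro image_eqI[of _ _ "inv \<pi> k"]) (auto simp: invp)
  qed
  have g: "(\<Sum>i\<in>{i\<in>{1..m}. \<pi> i < \<pi> j}. len i) = iet_endpoint ?\<mu> (\<pi> j - 1)"
    unfolding iet_endpoint_def im[symmetric] sum.reindex[OF injp] by (simp add: invp)
  have step: "iet_endpoint f k = iet_endpoint f (k - 1) + f k" if "k \<in> {1..m}" for f k
    using that by (cases k) (auto simp: iet_endpoint_def)
  define y where "y = iet m \<pi> len x"
  have y: "y = x - iet_endpoint len (j - 1) + iet_endpoint ?\<mu> (\<pi> j - 1)"
    unfolding y_def iet_eq[OF d x j] g ..
  have yI: "y \<in> iet_interval ?\<mu> (\<pi> j)"
    using j(2) y step[OF j(1), of len] step[OF pj, of ?\<mu>]
    by (auto simp: iet_interval_def invp)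
  have pos': "\<forall>i\<in>{1..m}. 0 < ?\<mu> i" and tot': "sum ?\<mu> {1..m} = 1"
    using d' unfolding iet_data_def by blast+
  have "0 \<le> iet_endpoint ?\<mu> (\<pi> j - 1)"
    unfolding iet_endpoint_def using pos' pj by (intro sum_nonneg less_imp_le) auto
  moreover have "iet_endpoint ?\<mu> (\<pi> j) \<le> sum ?\<mu> {1..m}"
    unfolding iet_endpoint_def
    by (rule sum_mono2) (use pos' pj in \<open>auto simp: less_imp_le simp del: o_apply comp_apply\<close>)
  ultimately have y01: "y \<in> {0..<1}" using yI tot' by (auto simp: iet_interval_def)
  then show "iet m \<pi> len x \<in> {0..<1}" by (simp add: y_def)
  have "{i\<in>{1..m}. inv \<pi> i < inv \<pi> (\<pi> j)} = \<pi> ` {1..j - 1}"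
  proof (intro equalityI subsetI)
    fix k assume k: "k \<in> {i\<in>{1..m}. inv \<pi> i < inv \<pi> (\<pi> j)}"
    then have "inv \<pi> k \<in> {1..m}" using permutes_in_image[OF permutes_inv[OF p]] by blast
    with k show "k \<in> \<pi> ` {1..j - 1}"
      by (intro image_eqI[of _ _ "inv \<pi> k"]) (auto simp: invp)
  next
    fix k assume "k \<in> \<pi> ` {1..j - 1}"
    then obtain i where i: "k = \<pi> i" "i \<in> {1..j - 1}" by blast
    then have "i \<in> {1..m}" using j by auto
    then have "\<pi> i \<in> {1..m}" using permutes_in_image[OF p] by blast
    with i show "k \<in> {i\<in>{1..m}. inv \<pi> i < inv \<pi> (\<pi> j)}" by (auto simp: invp)
  qed
  then have "(\<Sum>i\<in>{i\<in>{1..m}. inv \<pi> i < inv \<pi> (\<pi> j)}. ?\<mu> i) = iet_endpoint len (j - 1)"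
    by (simp add: sum.reindex[OF injp] invp iet_endpoint_def)
  then show "iet m (inv \<pi>) ?\<mu> (iet m \<pi> len x) = x"
    using iet_eq[OF d' y01 pj yI] y unfolding y_def by simp
qed

lemma
  assumes d: "iet_data m \<pi> len"
  shows bij_iet: "bij (iet m \<pi> len)"
    and bij_betw_iet: "bij_betw (iet m \<pi> len) {0..<1} {0..<1}"
    and inv_iet: "inv (iet m \<pi> len) = iet m (inv \<pi>) (len \<circ> inv \<pi>)"
proof -
  let ?T = "iet m \<pi> len" and ?U = "iet m (inv \<pi>) (len \<circ> inv \<pi>)"
  have p: "\<pi> permutes {1..m}" using d by (simp add: iet_data_def)
  have dd: "inv (inv \<pi>) = \<pi>" "(len \<circ> inv \<pi>) \<circ> \<pi> = len"
    using permutes_inv_inv[OF p] permutes_inverses[OF p] by (auto simp: fun_eq_iff)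
  note U = iet_inverse[OF iet_data_inv[OF d], unfolded dd]
  have out: "iet m' \<pi>' len' x = x" if "x \<notin> {0..<1}" for m' \<pi>' len' x using that by (simp only: iet_def if_False)
  have UT: "?U (?T x) = x" for x
    using iet_inverse(2)[OF d] out by (cases "x \<in> {0..<1}") auto
  have TU: "?T (?U x) = x" for x
    using U(2) out by (cases "x \<in> {0..<1}") auto
  show "bij ?T" by (rule o_bij[of ?U]) (auto simp: UT TU fun_eq_iff)
  show "inv ?T = ?U" by (rule inv_equality) (auto simp: UT TU)
  show "bij_betw ?T {0..<1} {0..<1}"
    by (rule bij_betw_byWitness[of _ ?U]) (use UT TU iet_inverse(1)[OF d] U(1) in auto)
qed

end

theory Submission
  imports Defs
begin

text \<open>Let \<open>T = S ^^ n\<close> and let \<open>L\<close> be the integer span of the lengths of \<open>T\<close>.  Since \<open>S\<close> commutes with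
  \<open>T\<close>, minimality forces the displacements \<open>S x - x\<close> to agree modulo \<open>L\<close> with a constant \<open>s\<close>, and
  \<open>S\<close> to break only at points of \<open>L\<close> and \<open>L - s\<close>.  Apply a \<open>\<rat>\<close>-linear coordinate
  functional \<open>b\<close> dual to the lengths: \<open>S\<close> preserves Lebesgue measure, so the integral of
  \<open>b (T x - x)\<close> is \<open>n\<close> times that of \<open>b (S x - x)\<close>.  Summation by parts computes the latter
  modulo \<open>L\<close>, and comparing coordinates gives \<open>A i j \<equiv> a i + \<nu> i * a j\<close> modulo \<open>n\<close>, where
  \<open>A i j = [\<pi> i < \<pi> j] - [i < j]\<close> is the antisymmetric matrix expressing the displacements of \<open>T\<close>
  in the lengths.  Modulo a prime divisor of \<open>n\<close>, antisymmetry turns this into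
  \<open>A i j \<equiv> a i - a j\<close>.  The sums \<open>A i j + A j k + A k i\<close> lie in \<open>{-1, 0, 1}\<close>, hence vanish, so
  the displacements of \<open>T\<close> differ by integers and \<open>T\<close> is a rotation.\<close>

section \<open>The group of integer combinations of the lengths\<close>

definition int_span :: "('i \<Rightarrow> real) \<Rightarrow> 'i set \<Rightarrow> real set" where
  "int_span f I = range (\<lambda>z::'i \<Rightarrow> int. \<Sum>i\<in>I. of_int (z i) * f i)"

lemma int_spanI: "x = (\<Sum>i\<in>I. of_int (z i) * f i) \<Longrightarrow> x \<in> int_span f I"
  unfolding int_span_def by blast

lemma int_span_0 [simp]: "0 \<in> int_span f I"
  by (rule int_spanI[where z="\<lambda>_. 0"]) simp

lemma int_span_add:
  assumes "x \<in> int_span f I" "y \<in> int_span f I"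
  shows "x + y \<in> int_span f I"
proof -
  obtain u v :: "'a \<Rightarrow> int" where "x = (\<Sum>i\<in>I. of_int (u i) * f i)" "y = (\<Sum>i\<in>I. of_int (v i) * f i)"
    using assms unfolding int_span_def by blast
  then show ?thesis
    by (intro int_spanI[where z="\<lambda>i. u i + v i"]) (simp add: sum.distrib algebra_simps)
qed

lemma int_span_mult:
  assumes "x \<in> int_span f I"
  shows "of_int k * x \<in> int_span f I"
proof -
  obtain u :: "'a \<Rightarrow> int" where "x = (\<Sum>i\<in>I. of_int (u i) * f i)"
    using assms unfolding int_span_def by blast
  then show ?thesis
    by (intro int_spanI[where z="\<lambda>i. k * u i"]) (simp add: sum_distrib_left algebra_simps)
qed

lemma int_span_minus: "x \<in> int_span f I \<Longrightarrow> - x \<in> int_span f I"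
  using int_span_mult[of x f I "-1"] by simp

lemma int_span_diff: "x \<in> int_span f I \<Longrightarrow> y \<in> int_span f I \<Longrightarrow> x - y \<in> int_span f I"
  using int_span_add[OF _ int_span_minus] by fastforce

lemma int_span_subset_sum:
  assumes "finite I" "J \<subseteq> I"
  shows "sum f J \<in> int_span f I"
proof (rule int_spanI[where z="\<lambda>i. of_bool (i \<in> J)"])
  show "sum f J = (\<Sum>i\<in>I. of_int (of_bool (i \<in> J)) * f i)"
    using assms by (intro sum.mono_neutral_cong_left) auto
qed

section \<open>Points where a map is locally a translation\<close>

text \<open>The failure of this property is what breaking at \<open>x\<close> means.\<close>

definition loc_transl :: "(real \<Rightarrow> real) \<Rightarrow> real \<Rightarrow> bool" where
  "loc_transl f x \<longleftrightarrow> (\<exists>e>0. \<forall>d. \<bar>d\<bar> < e \<longrightarrow> f (x + d) = f x + d)"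

lemma loc_transl_comp:
  assumes "loc_transl f x" "loc_transl g (f x)"
  shows "loc_transl (g \<circ> f) x"
proof -
  obtain e1 e2 where "e1 > 0" "\<forall>d. \<bar>d\<bar> < e1 \<longrightarrow> f (x + d) = f x + d"
     "e2 > 0" "\<forall>d. \<bar>d\<bar> < e2 \<longrightarrow> g (f x + d) = g (f x) + d"
    using assms unfolding loc_transl_def by blast
  then show ?thesis unfolding loc_transl_def by (intro exI[of _ "min e1 e2"]) simp
qed

text \<open>For small \<open>d\<close> both \<open>f (g (x + d))\<close> and
  \<open>f (g x + d)\<close> equal \<open>f (g x) + d\<close>, and injectivity cancels
  \<open>f\<close>.\<close>

lemma loc_transl_comp_cancel:
  assumes "inj f" "loc_transl f (g x)" "loc_transl (f \<circ> g) x"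
  shows "loc_transl g x"
proof -
  obtain e1 e2 where e: "e1 > 0" "\<And>d. \<bar>d\<bar> < e1 \<Longrightarrow> f (g x + d) = f (g x) + d"
     "e2 > 0" "\<And>d. \<bar>d\<bar> < e2 \<Longrightarrow> f (g (x + d)) = f (g x) + d"
    using assms(2,3) unfolding loc_transl_def comp_def by blast
  have "g (x + d) = g x + d" if "\<bar>d\<bar> < min e1 e2" for d
    using e(2)[of d] e(4)[of d] that injD[OF assms(1)] by auto
  then show ?thesis unfolding loc_transl_def using e(1,3) by (intro exI[of _ "min e1 e2"]) auto
qed

lemma loc_transl_funpow:
  assumes "\<And>k. loc_transl f ((f ^^ k) x)"
  shows "loc_transl (f ^^ n) x"
proof (induction n)
  case 0
  show ?case unfolding loc_transl_def by (intro exI[of _ 1]) simp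
next
  case (Suc n)
  show ?case using loc_transl_comp[OF Suc assms[of n]] by (simp add: comp_def)
qed

section \<open>Displacements and breakpoints of an interval exchange\<close>

definition iet_shift :: "nat \<Rightarrow> (nat \<Rightarrow> nat) \<Rightarrow> (nat \<Rightarrow> real) \<Rightarrow> nat \<Rightarrow> real" where
  "iet_shift m \<pi> len j = (\<Sum>i\<in>{i\<in>{1..m}. \<pi> i < \<pi> j}. len i) - iet_endpoint len (j - 1)"

text \<open>For injective \<open>\<pi>\<close> this is nonzero exactly on the pairs that
  \<open>\<pi>\<close> inverts. It is the coefficient of \<open>len i\<close> in the displacement of
  the \<open>j\<close>-th interval.\<close>

definition inversion_sign :: "(nat \<Rightarrow> nat) \<Rightarrow> nat \<Rightarrow> nat \<Rightarrow> int" where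
  "inversion_sign \<pi> i j = of_bool (\<pi> i < \<pi> j) - of_bool (i < j)"

lemma iet_eq_shift:
  assumes "iet_data m \<pi> len" "x \<in> {0..<1}" "j \<in> {1..m}" "x \<in> iet_interval len j"
  shows "iet m \<pi> len x = x + iet_shift m \<pi> len j"
  using iet_eq[OF assms] by (simp add: iet_shift_def)

lemma iet_shift_eq:
  assumes "j \<in> {1..m}"
  shows "iet_shift m \<pi> len j = (\<Sum>i=1..m. of_int (inversion_sign \<pi> i j) * len i)"
proof -
  have "(\<Sum>i\<in>{i\<in>{1..m}. \<pi> i < \<pi> j}. len i) = (\<Sum>i=1..m. of_bool (\<pi> i < \<pi> j) * len i)"
    by (rule sum.mono_neutral_cong_left) auto
  moreover have "iet_endpoint len (j - 1) = (\<Sum>i=1..m. of_bool (i < j) * len i)"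
    unfolding iet_endpoint_def using assms by (intro sum.mono_neutral_cong_left) auto
  ultimately show ?thesis
    by (simp add: iet_shift_def inversion_sign_def sum_subtractf algebra_simps)
qed

lemma iet_shift_int_span: "j \<in> {1..m} \<Longrightarrow> iet_shift m \<pi> len j \<in> int_span len {1..m}"
  using iet_shift_eq by (rule int_spanI)

lemma iet_endpoint_int_span: "j \<le> m \<Longrightarrow> iet_endpoint len j \<in> int_span len {1..m}"
  unfolding iet_endpoint_def by (rule int_span_subset_sum) auto

lemma iet_endpoint_Suc: "iet_endpoint len (Suc j) = iet_endpoint len j + len (Suc j)"
  by (simp add: iet_endpoint_def)

lemma iet_endpoint_mono:
  assumes "iet_data m \<pi> len" "a \<le> b" "b \<le> m"
  shows "iet_endpoint len a \<le> iet_endpoint len b"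
  unfolding iet_endpoint_def using assms
  by (intro sum_mono2) (auto simp: iet_data_def intro: less_imp_le)

lemma iet_interval_subset:
  assumes "iet_data m \<pi> len" "j \<in> {1..m}"
  shows "iet_interval len j \<subseteq> {0..<1}"
proof -
  have "iet_endpoint len 0 \<le> iet_endpoint len (j - 1)" "iet_endpoint len j \<le> iet_endpoint len m"
    using assms by (auto intro!: iet_endpoint_mono)
  moreover have "iet_endpoint len 0 = 0" "iet_endpoint len m = 1"
    using assms by (auto simp: iet_endpoint_def iet_data_def)
  ultimately show ?thesis by (auto simp: iet_interval_def)
qed

lemma iet_interval_cases:
  assumes "iet_data m \<pi> len" "x \<in> {0..<1}"
  obtains j where "j \<in> {1..m}" "x \<in> iet_interval len j"
  using ex1_iet_interval[of m len x] assms unfolding iet_data_def by blast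

lemma sum_indicator_iet_interval:
  assumes "iet_data m \<pi> len"
  shows "(\<Sum>j=1..m. indicator (iet_interval len j) x) = (indicator {0..<1} x :: real)"
proof (cases "x \<in> {0..<1}")
  case True
  then obtain j where j: "j \<in> {1..m}" "x \<in> iet_interval len j"
    using iet_interval_cases[OF assms] by blast
  have u: "x \<in> iet_interval len k \<longleftrightarrow> k = j" if "k \<in> {1..m}" for k
    using ex1_iet_interval[of m len x] assms True j that unfolding iet_data_def by blast
  have "(\<Sum>k=1..m. indicator (iet_interval len k) x) = (\<Sum>k=1..m. if k = j then 1 else (0::real))"
    by (rule sum.cong) (simp_all only: indicator_def u of_bool_def)
  with True j show ?thesis by simp
next
  case False
  then have "x \<notin> iet_interval len j" if "j \<in> {1..m}" for j
    using iet_interval_subset[OF assms that] by blast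
  then show ?thesis using False by (subst sum.neutral) (auto simp del: atLeastLessThan_iff)
qed

text \<open>The excluded endpoints include 0: to its left the map is the identity, whose
  displacement need not match that of the first interval.\<close>

lemma loc_transl_iet:
  assumes d: "iet_data m \<pi> len" and x: "x \<in> {0..<1}" "x \<notin> iet_endpoint len ` {0..m}"
  shows "loc_transl (iet m \<pi> len) x"
proof -
  obtain j where j: "j \<in> {1..m}" "x \<in> iet_interval len j"
    using iet_interval_cases[OF d x(1)] by blast
  have "x \<noteq> iet_endpoint len (j - 1)" using x(2) j(1) by force
  then have b: "iet_endpoint len (j - 1) < x" "x < iet_endpoint len j"
    using j(2) by (auto simp: iet_interval_def)
  have "iet m \<pi> len (x + h) = iet m \<pi> len x + h"
    if "\<bar>h\<bar> < min (x - iet_endpoint len (j - 1)) (iet_endpoint len j - x)" for h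
  proof -
    have "x + h \<in> iet_interval len j" using that by (auto simp: iet_interval_def)
    then have "iet m \<pi> len (x + h) = x + h + iet_shift m \<pi> len j"
      using iet_interval_subset[OF d j(1)] by (intro iet_eq_shift[OF d _ j(1)]) auto
    then show ?thesis using iet_eq_shift[OF d x(1) j] by simp
  qed
  with b show ?thesis unfolding loc_transl_def
    by (intro exI[of _ "min (x - iet_endpoint len (j - 1)) (iet_endpoint len j - x)"]) auto
qed

lemma iet_shift_Suc_eq:
  assumes d: "iet_data m \<pi> len" and j: "1 \<le> j" "Suc j \<le> m"
    and l: "loc_transl (iet m \<pi> len) (iet_endpoint len j)"
  shows "iet_shift m \<pi> len (Suc j) = iet_shift m \<pi> len j"
proof -
  let ?x = "iet_endpoint len j"
  obtain e where e: "e > 0" "\<And>h. \<bar>h\<bar> < e \<Longrightarrow> iet m \<pi> len (?x + h) = iet m \<pi> len ?x + h"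
    using l unfolding loc_transl_def by blast
  have pos: "len j > 0" "len (Suc j) > 0" using d j by (auto simp: iet_data_def)
  have step: "?x = iet_endpoint len (j - 1) + len j"
    using iet_endpoint_Suc[of len "j - 1"] j by simp
  \<comment> \<open>Even \<open>h = len j\<close> is admissible, since the half-open
    \<open>j\<close>-th interval contains its left endpoint \<open>?x - len j\<close>.\<close>
  define h where "h = min (e / 2) (len j)"
  have "?x \<in> iet_interval len (Suc j)" using pos by (simp add: iet_interval_def iet_endpoint_Suc)
  then have 1: "iet m \<pi> len ?x = ?x + iet_shift m \<pi> len (Suc j)"
    using iet_eq_shift[OF d, of ?x "Suc j"] iet_interval_subset[OF d, of "Suc j"] j by auto
  have "?x - h \<in> iet_interval len j" using pos e(1) step by (auto simp: iet_interval_def h_def)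
  then have 2: "iet m \<pi> len (?x - h) = ?x - h + iet_shift m \<pi> len j"
    using iet_eq_shift[OF d, of "?x - h" j] iet_interval_subset[OF d, of j] j by auto
  have "iet m \<pi> len (?x - h) = iet m \<pi> len ?x - h"
    using e(2)[of "- h"] e(1) pos by (simp add: h_def)
  with 1 2 show ?thesis by simp
qed

lemma iet_diff_int_span:
  assumes d: "iet_data m \<pi> len"
  shows "iet m \<pi> len x - x \<in> int_span len {1..m}"
proof (cases "x \<in> {0..<1}")
  case True
  then obtain j where j: "j \<in> {1..m}" "x \<in> iet_interval len j"
    using iet_interval_cases[OF d] by blast
  from iet_eq_shift[OF d True j] iet_shift_int_span[OF j(1)] show ?thesis by simp
next
  case False
  then have "iet m \<pi> len x = x" by (simp only: iet_def if_False)
  then show ?thesis by simp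
qed

lemma iet_in_unit:
  assumes "iet_data m \<pi> len"
  shows "iet m \<pi> len x \<in> {0..<1} \<longleftrightarrow> x \<in> {0..<1}"
proof (cases "x \<in> {0..<1}")
  case False
  then show ?thesis by (simp only: iet_def if_False)
qed (use iet_inverse(1)[OF assms] in simp)

section \<open>Invariance of Lebesgue measure and integrals of displacements\<close>

text \<open>The exchanged intervals are translated, and their images again partition the unit
  interval; so \<open>g\<close> is cut along the images and each piece is translated back.\<close>

lemma has_integral_iet_comp:
  fixes g :: "real \<Rightarrow> real"
  assumes d: "iet_data m \<pi> len"
    and g: "has_bochner_integral lborel (\<lambda>x. indicator {0..<1} x * g x) v"
  shows "has_bochner_integral lborel (\<lambda>x. indicator {0..<1} x * g (iet m \<pi> len x)) v"
proof -
  let ?T = "iet m \<pi> len" and ?t = "iet_shift m \<pi> len"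
  let ?f = "\<lambda>j y. indicator (iet_interval len j) (y - ?t j) * g y"
  have T: "?T x = x + ?t j" if "j \<in> {1..m}" "x \<in> iet_interval len j" for x j
    using iet_eq_shift[OF d _ that] iet_interval_subset[OF d] that by blast
  have inj: "inj ?T" using bij_iet[OF d] by (simp add: bij_is_inj)
  \<comment> \<open>If \<open>?T x - ?t j\<close> lies in the \<open>j\<close>-th interval, then
    \<open>?T\<close> sends it to \<open>?T x\<close>, so it equals \<open>x\<close> by
    injectivity.\<close>
  have img: "indicator (iet_interval len j) (?T x - ?t j) = (indicator (iet_interval len j) x :: real)"
    if "j \<in> {1..m}" for x j
  proof -
    have "x \<in> iet_interval len j" if "?T x - ?t j \<in> iet_interval len j"
    proof -
      have "?T (?T x - ?t j) = ?T x" using T[OF \<open>j \<in> {1..m}\<close> that] by simp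
      with that show ?thesis using injD[OF inj] by metis
    qed
    then show ?thesis using T[OF that] by (auto simp: indicator_def)
  qed
  have sumf: "(\<Sum>j=1..m. ?f j y) = indicator {0..<1} y * g y" for y
  proof -
    obtain x where y: "y = ?T x" using bij_iet[OF d] by (meson bij_pointE)
    have "(\<Sum>j=1..m. ?f j y) = (\<Sum>j=1..m. indicator (iet_interval len j) x) * g y"
      unfolding sum_distrib_right by (rule sum.cong) (use img in \<open>auto simp: y\<close>)
    also have "\<dots> = indicator {0..<1} y * g y"
      unfolding sum_indicator_iet_interval[OF d] y using iet_in_unit[OF d, of x]
      by (simp add: indicator_def)
    finally show ?thesis .
  qed
  have int: "integrable lborel (?f j)" if j: "j \<in> {1..m}" for j
  proof -
    have eq: "?f j y = indicator ((\<lambda>x. x + ?t j) ` iet_interval len j) y * (indicator {0..<1} y * g y)" for y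
    proof -
      have "y \<in> {0..<1}" if "y - ?t j \<in> iet_interval len j"
        using T[OF j that] iet_in_unit[OF d, of "y - ?t j"] iet_interval_subset[OF d j] that by auto
      then show ?thesis by (force simp: indicator_def image_iff)
    qed
    have "(\<lambda>x. x + ?t j) ` iet_interval len j \<in> sets lborel"
      unfolding iet_interval_def by simp
    from integrable_mult_indicator[OF this integrable.intros[OF g]]
    show ?thesis unfolding eq by simp
  qed
  have "has_bochner_integral lborel (\<lambda>x. ?f j (?t j + 1 * x)) (integral\<^sup>L lborel (?f j))"
    if "j \<in> {1..m}" for j
    using lborel_has_bochner_integral_real_affine_iff[of 1 "?f j" _ "?t j"]
      has_bochner_integral_integrable int that by fastforce
  then have "has_bochner_integral lborel (\<lambda>x. \<Sum>j=1..m. ?f j (?t j + 1 * x))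
      (\<Sum>j=1..m. integral\<^sup>L lborel (?f j))"
    by (rule has_bochner_integral_sum)
  moreover have "(\<Sum>j=1..m. integral\<^sup>L lborel (?f j)) = v"
    using Bochner_Integration.integral_sum[of "{1..m}" lborel ?f, OF int]
      has_bochner_integral_integral_eq[OF g] by (simp only: sumf)
  moreover have "(\<Sum>j=1..m. ?f j (?t j + 1 * x)) = indicator {0..<1} x * g (?T x)" for x
  proof -
    have "(\<Sum>j=1..m. ?f j (?t j + 1 * x)) = (\<Sum>j=1..m. indicator (iet_interval len j) x * g (?T x))"
      using T by (intro sum.cong) (auto simp: indicator_def add.commute)
    then show ?thesis unfolding sum_distrib_right[symmetric] sum_indicator_iet_interval[OF d] .
  qed
  ultimately show ?thesis by simp
qed

text \<open>The integrand is a step function, constant on each exchanged interval. So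
  \<open>b\<close> may be as wild as a discontinuous \<rat>-linear functional.\<close>

lemma has_integral_iet_shift:
  fixes b :: "real \<Rightarrow> real"
  assumes d: "iet_data m \<pi> len"
  shows "has_bochner_integral lborel (\<lambda>x. indicator {0..<1} x * b (iet m \<pi> len x - x))
    (\<Sum>j=1..m. len j * b (iet_shift m \<pi> len j))"
proof -
  have "has_bochner_integral lborel (\<lambda>x. indicator (iet_interval len j) x * b (iet_shift m \<pi> len j))
     (len j * b (iet_shift m \<pi> len j))" if "j \<in> {1..m}" for j
  proof -
    have "iet_endpoint len j = iet_endpoint len (j - 1) + len j" "0 < len j"
      using iet_endpoint_Suc[of len "j - 1"] that d by (auto simp: iet_data_def)
    then have "emeasure lborel (iet_interval len j) < \<infinity>" "measure lborel (iet_interval len j) = len j"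
      by (auto simp: iet_interval_def)
    then have "has_bochner_integral lborel (indicator (iet_interval len j)) (len j)"
      using has_bochner_integral_real_indicator[of "iet_interval len j" lborel]
      by (simp add: iet_interval_def)
    then show ?thesis by (rule has_bochner_integral_mult_left[rotated])
  qed
  then have "has_bochner_integral lborel
     (\<lambda>x. \<Sum>j=1..m. indicator (iet_interval len j) x * b (iet_shift m \<pi> len j))
     (\<Sum>j=1..m. len j * b (iet_shift m \<pi> len j))"
    by (rule has_bochner_integral_sum)
  moreover have "(\<Sum>j=1..m. indicator (iet_interval len j) x * b (iet_shift m \<pi> len j)) =
      indicator {0..<1} x * b (iet m \<pi> len x - x)" for x
  proof -
    have "indicator (iet_interval len j) x * b (iet_shift m \<pi> len j) =
        indicator (iet_interval len j) x * b (iet m \<pi> len x - x)" if "j \<in> {1..m}" for j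
      using iet_eq_shift[OF d _ that, of x] iet_interval_subset[OF d that]
      by (cases "x \<in> iet_interval len j") auto
    then have "(\<Sum>j=1..m. indicator (iet_interval len j) x * b (iet_shift m \<pi> len j)) =
        (\<Sum>j=1..m. indicator (iet_interval len j) x) * b (iet m \<pi> len x - x)"
      unfolding sum_distrib_right by (intro sum.cong) auto
    then show ?thesis by (simp only: sum_indicator_iet_interval[OF d])
  qed
  ultimately show ?thesis by simp
qed

text \<open>The displacement of the power telescopes along an orbit of the root, \<open>b\<close>
  respects the telescoping, and by invariance all \<open>n\<close> terms have the same
  integral.\<close>

lemma sum_shift_iet_power:
  fixes b :: "real \<Rightarrow> real"
  assumes d: "iet_data m \<pi> len" and e: "iet_data r \<sigma> \<mu>"
    and n: "iet m \<pi> len = iet r \<sigma> \<mu> ^^ n" and b: "Modules.additive b"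
  shows "(\<Sum>j=1..m. len j * b (iet_shift m \<pi> len j)) =
    of_nat n * (\<Sum>k=1..r. \<mu> k * b (iet_shift r \<sigma> \<mu> k))"
proof -
  let ?S = "iet r \<sigma> \<mu>" and ?V = "\<Sum>k=1..r. \<mu> k * b (iet_shift r \<sigma> \<mu> k)"
  have "has_bochner_integral lborel
      (\<lambda>x. indicator {0..<1} x * b (?S ((?S ^^ k) x) - (?S ^^ k) x)) ?V" for k
  proof (induction k)
    case 0
    show ?case using has_integral_iet_shift[OF e] by simp
  next
    case (Suc k)
    from has_integral_iet_comp[OF e Suc] show ?case by (simp only: funpow_Suc_right comp_apply)
  qed
  then have "has_bochner_integral lborel
      (\<lambda>x. \<Sum>k<n. indicator {0..<1} x * b (?S ((?S ^^ k) x) - (?S ^^ k) x)) (\<Sum>k<n. ?V)"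
    by (intro has_bochner_integral_sum)
  moreover have "(\<Sum>k<n. b (?S ((?S ^^ k) x) - (?S ^^ k) x)) = b ((?S ^^ n) x - x)" for x
    using Modules.additive.zero[OF b] by (induction n) (auto simp: Modules.additive.diff[OF b])
  ultimately have "has_bochner_integral lborel (\<lambda>x. indicator {0..<1} x * b ((?S ^^ n) x - x)) (of_nat n * ?V)"
    by (simp add: sum_distrib_left[symmetric])
  then show ?thesis
    using has_integral_iet_shift[OF d, of b] unfolding n by (blast intro: has_bochner_integral_eq)
qed

section \<open>Maps commuting with a minimal interval exchange\<close>

text \<open>The full orbit of a periodic point is finite, hence closed, and cannot be dense in the
  unit interval.\<close>

lemma minimal_iet_aperiodic:
  assumes m: "minimal_iet T" and T: "bij T" and x: "x \<in> {0..<1}" and k: "0 < k"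
  shows "(T ^^ k) x \<noteq> x"
proof
  assume p: "(T ^^ k) x = x"
  define F where "F = (\<lambda>i. (T ^^ i) x) ` {..<k}"
  have fin: "finite F" by (simp add: F_def)
  have xF: "x \<in> F" unfolding F_def by (rule image_eqI[where x=0]) (use k in auto)
  have TF: "T ` F \<subseteq> F"
  proof
    fix y assume "y \<in> T ` F"
    then obtain i where i: "y = (T ^^ Suc i) x" "i < k" unfolding F_def by auto
    show "y \<in> F"
    proof (cases "Suc i < k")
      case True
      then show ?thesis unfolding F_def i(1) by blast
    next
      case False
      then have "Suc i = k" using i(2) by simp
      with i(1) p xF show ?thesis by simp
    qed
  qed
  \<comment> \<open>An injective self-map of a finite set is onto, so the backward orbit stays in
    \<open>F\<close> as well.\<close>
  then have "T ` F = F" using T fin by (metis bij_is_inj endo_inj_surj inj_on_subset subset_UNIV)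
  then have "inv T ` F = F" using T by (metis bij_is_inj image_inv_f_f)
  then have "(T ^^ i) x \<in> F" "(inv T ^^ i) x \<in> F" for i
    using TF xF by (induction i) auto
  then have "full_orbit T x \<subseteq> F" unfolding full_orbit_def by blast
  then have fin': "finite (full_orbit T x)" using fin finite_subset by blast
  then have "closure (full_orbit T x) = full_orbit T x" by (simp add: finite_imp_closed)
  then have "finite {0..<1::real}"
    using fin' m x unfolding minimal_iet_def by (metis finite_subset)
  then show False using infinite_Ico[of 0 "1::real"] by simp
qed

text \<open>Modulo the integer span of the lengths of \<open>T\<close>, the displacement of a map \<open>S\<close> commuting
  with \<open>T\<close> is \<open>T\<close>-invariant; as a step function it is then constant by minimality.\<close>

lemma commuting_displacement_int_span:
  assumes d: "iet_data m \<pi> len" and e: "iet_data r \<sigma> \<mu>" and min: "minimal_iet (iet m \<pi> len)"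
    and comm: "iet r \<sigma> \<mu> \<circ> iet m \<pi> len = iet m \<pi> len \<circ> iet r \<sigma> \<mu>" and k: "k \<in> {1..r}"
  shows "iet_shift r \<sigma> \<mu> k - iet r \<sigma> \<mu> 0 \<in> int_span len {1..m}"
proof -
  let ?T = "iet m \<pi> len" and ?S = "iet r \<sigma> \<mu>" and ?L = "int_span len {1..m}"
  have bij: "bij ?T" by (rule bij_iet[OF d])
  \<comment> \<open>Commutation turns the change of the displacement of \<open>?S\<close> along
    \<open>?T\<close> into a difference of two displacements of \<open>?T\<close>, both in
    \<open>?L\<close>.\<close>
  have inv: "(?S (?T y) - ?T y) - (?S y - y) \<in> ?L" for y
  proof -
    have "?S (?T y) = ?T (?S y)" using comm by (simp add: fun_eq_iff)
    then have "(?S (?T y) - ?T y) - (?S y - y) = (?T (?S y) - ?S y) - (?T y - y)" by simp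
    then show ?thesis using iet_diff_int_span[OF d] int_span_diff by metis
  qed
  have fwd: "?S ((?T ^^ i) 0) - (?T ^^ i) 0 - ?S 0 \<in> ?L" for i
  proof (induction i)
    case (Suc i)
    from int_span_add[OF inv[of "(?T ^^ i) 0"] Suc] show ?case by (simp add: algebra_simps)
  qed simp
  have bwd: "?S ((inv ?T ^^ i) 0) - (inv ?T ^^ i) 0 - ?S 0 \<in> ?L" for i
  proof (induction i)
    case (Suc i)
    have "?T (inv ?T ((inv ?T ^^ i) 0)) = (inv ?T ^^ i) 0" using bij by (simp add: bij_is_surj surj_f_inv_f)
    with int_span_diff[OF Suc inv[of "inv ?T ((inv ?T ^^ i) 0)"]] show ?case
      by (simp add: algebra_simps)
  qed simp
  define a b where "a = iet_endpoint \<mu> (k - 1)" and "b = iet_endpoint \<mu> k"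
  have "b = a + \<mu> k" "0 < \<mu> k"
    using iet_endpoint_Suc[of \<mu> "k - 1"] k e by (auto simp: a_def b_def iet_data_def)
  then have ab: "a < b" by simp
  have I: "iet_interval \<mu> k = {a..<b}" by (simp add: iet_interval_def a_def b_def)
  have sub: "{a..<b} \<subseteq> {0..<1}" using iet_interval_subset[OF e k] I by simp
  \<comment> \<open>Density yields orbit points in open sets only, so the interior of the interval
    is used, with its midpoint as a point of the closure.\<close>
  have "(a + b) / 2 \<in> {a..<b}" using ab by (simp add: field_simps)
  then have "(a + b) / 2 \<in> closure (full_orbit ?T 0)"
    using min sub unfolding minimal_iet_def by fastforce
  then have "{a<..<b} \<inter> full_orbit ?T 0 \<noteq> {}"
    using ab open_Int_closure_eq_empty[of "{a<..<b}" "full_orbit ?T 0"]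
    by (auto simp: disjoint_iff simp del: Int_iff dest!: bspec[where x="(a + b) / 2"] spec[where x="(a + b) / 2"])
  then obtain y where y: "y \<in> full_orbit ?T 0" "y \<in> iet_interval \<mu> k" unfolding I by force
  have "?S y - y - ?S 0 \<in> ?L" using y(1) fwd bwd unfolding full_orbit_def by blast
  then show ?thesis using iet_eq_shift[OF e _ k y(2)] sub y(2) unfolding I by auto
qed

text \<open>If \<open>S\<close> breaks at \<open>x\<close>, where neither \<open>x\<close> nor \<open>S x\<close> lies in the integer span of the lengths,
  then it breaks along the whole forward \<open>T\<close>-orbit of \<open>x\<close>, which is infinite.\<close>

lemma commuting_loc_transl:
  assumes d: "iet_data m \<pi> len" and e: "iet_data r \<sigma> \<mu>" and min: "minimal_iet (iet m \<pi> len)"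
    and comm: "iet r \<sigma> \<mu> \<circ> iet m \<pi> len = iet m \<pi> len \<circ> iet r \<sigma> \<mu>"
    and x: "x \<in> {0..<1}" "x \<notin> int_span len {1..m}" "iet r \<sigma> \<mu> x \<notin> int_span len {1..m}"
  shows "loc_transl (iet r \<sigma> \<mu>) x"
proof (rule ccontr)
  let ?T = "iet m \<pi> len" and ?S = "iet r \<sigma> \<mu>" and ?L = "int_span len {1..m}"
  assume nl: "\<not> loc_transl ?S x"
  \<comment> \<open>Since \<open>?T\<close> moves points by elements of \<open>?L\<close>, an orbit
    starting outside \<open>?L\<close> never enters it, and so never meets an endpoint of the
    intervals of \<open>?T\<close>.\<close>
  have orb: "(?T ^^ k) y \<in> {0..<1} \<and> (?T ^^ k) y \<notin> ?L" if "y \<in> {0..<1}" "y \<notin> ?L" for y k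
  proof (induction k)
    case (Suc k)
    let ?z = "(?T ^^ k) y"
    have "?z \<in> ?L" if "?T ?z \<in> ?L"
      using int_span_diff[OF that iet_diff_int_span[OF d, of ?z]] by simp
    then show ?case using Suc iet_in_unit[OF d, of ?z] by auto
  qed (use that in auto)
  have locT: "loc_transl (?T ^^ n) y" if "y \<in> {0..<1}" "y \<notin> ?L" for y n
  proof (rule loc_transl_funpow)
    fix k
    show "loc_transl ?T ((?T ^^ k) y)"
      using orb[OF that, of k] iet_endpoint_int_span[of _ m len]
      by (intro loc_transl_iet[OF d]) auto
  qed
  have Sx: "?S x \<in> {0..<1}" using iet_in_unit[OF e] x(1) by simp
  have cn: "?S \<circ> ?T ^^ n = ?T ^^ n \<circ> ?S" for n
  proof (induction n)
    case (Suc n)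
    then show ?case using comm by (metis comp_assoc funpow.simps(2))
  qed simp
  \<comment> \<open>Otherwise \<open>?S \<circ> ?T ^^ n\<close>, which is
    \<open>?T ^^ n \<circ> ?S\<close>, would be locally a translation at \<open>x\<close>;
    cancelling \<open>?T ^^ n\<close> at \<open>?S x\<close> would make \<open>?S\<close> one at
    \<open>x\<close>.\<close>
  have "\<not> loc_transl ?S ((?T ^^ n) x)" for n
  proof
    assume "loc_transl ?S ((?T ^^ n) x)"
    from loc_transl_comp[OF locT[OF x(1,2)] this] have l: "loc_transl (?T ^^ n \<circ> ?S) x"
      by (simp only: cn)
    have "inj (?T ^^ n)" using bij_iet[OF d] by (simp add: bij_is_inj inj_fn)
    with loc_transl_comp_cancel[OF _ locT[OF Sx x(3)] l] nl show False by blast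
  qed
  then have "(?T ^^ n) x \<in> iet_endpoint \<mu> ` {0..r}" for n
    using loc_transl_iet[OF e] orb[OF x(1,2)] by blast
  then have "{y. \<exists>n. y = (?T ^^ n) x} \<subseteq> iet_endpoint \<mu> ` {0..r}" by blast
  then have fin: "finite {y. \<exists>n. y = (?T ^^ n) x}" by (rule finite_subset) simp
  obtain k where "k > 0" "(?T ^^ k) x = x"
    using funpow_inj_finite[OF bij_is_inj[OF bij_iet[OF d]] fin] by blast
  then show False using minimal_iet_aperiodic[OF min bij_iet[OF d] x(1)] by blast
qed

section \<open>Coordinates of displacements modulo the exponent\<close>

text \<open>The dual values on the independent family extend to a \<rat>-linear functional on all
  reals.\<close>

lemma lin_indep_dual_functional:
  assumes ind: "lin_indep_over_rat f I" and k: "k \<in> I"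
  shows "\<exists>b :: real \<Rightarrow> real. Modules.additive b \<and> (\<forall>(z::int) x. b (of_int z * x) = of_int z * b x) \<and>
    (\<forall>i\<in>I. b (f i) = of_bool (i = k))"
proof -
  let ?s = "\<lambda>(q::rat) (x::real). of_rat q * x"
  have vs: "vector_space ?s" by unfold_locales (auto simp: algebra_simps of_rat_add of_rat_mult)
  then have vp: "vector_space_pair ?s ?s" by (simp add: vector_space_pair_def)
  have inj: "inj_on f I" and i: "module.independent ?s (f ` I)"
    using ind by (auto simp: lin_indep_over_rat_def)
  obtain b where b: "Vector_Spaces.linear ?s ?s b" "\<forall>x\<in>f ` I. b x = of_bool (x = f k)"
    using vector_space_pair.linear_independent_extend[OF vp i, of "\<lambda>x. of_bool (x = f k)"] by blast
  interpret b: Vector_Spaces.linear ?s ?s b by fact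
  show ?thesis
  proof (intro exI[of _ b] conjI allI ballI)
    show "Modules.additive b" by unfold_locales (rule b.add)
    show "b (of_int z * x) = of_int z * b x" for z :: int and x using b.scale[of "of_int z" x] by simp
    show "b (f i) = of_bool (i = k)" if "i \<in> I" for i
      using b(2) inj k that by (auto dest: inj_onD)
  qed
qed

text \<open>With \<open>s\<close> the displacement of the root \<open>S\<close> at \<open>0\<close>, the integer \<open>a i\<close> is the \<open>i\<close>-th coordinate
  of \<open>n * s\<close>, and \<open>\<nu> i\<close> is the sum of the \<open>i\<close>-th coordinates of the jumps of \<open>S\<close> at its breakpoints in
  \<open>L - s\<close>, where \<open>L\<close> is the integer span of the lengths.\<close>

lemma iet_power_inversion_sign_cong:
  assumes d: "iet_data m \<pi> len" and e: "iet_data r \<sigma> \<mu>" and min: "minimal_iet (iet m \<pi> len)"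
    and ind: "lin_indep_over_rat len {1..m}" and n: "iet m \<pi> len = iet r \<sigma> \<mu> ^^ n"
  shows "\<exists>a \<nu>. \<forall>i\<in>{1..m}. \<forall>j\<in>{1..m}. int n dvd inversion_sign \<pi> i j - a i - \<nu> i * a j"
proof -
  let ?T = "iet m \<pi> len" and ?S = "iet r \<sigma> \<mu>" and ?L = "int_span len {1..m}"
  let ?t = "iet_shift m \<pi> len" and ?u = "iet_shift r \<sigma> \<mu>" and ?g = "iet_endpoint \<mu>"
  define s where "s = ?S 0"
  have comm: "?S \<circ> ?T = ?T \<circ> ?S" unfolding n by (metis funpow.simps(2) funpow_Suc_right)
  have us: "?u k - s \<in> ?L" if "k \<in> {1..r}" for k
    unfolding s_def by (rule commuting_displacement_int_span[OF d e min comm that])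
  have r: "1 \<le> r" using e by (simp add: iet_data_def)
  have g1: "?g r = 1" using e by (simp add: iet_endpoint_def iet_data_def)
  have dS: "?S x - x - s \<in> ?L" if x: "x \<in> {0..<1}" for x
  proof -
    obtain k where "k \<in> {1..r}" "x \<in> iet_interval \<mu> k" using iet_interval_cases[OF e x] by blast
    then show ?thesis using iet_eq_shift[OF e x] us by (metis add_diff_cancel_left')
  qed
  have unit: "(?S ^^ k) 0 \<in> {0..<1}" for k using iet_in_unit[OF e] by (induction k) auto
  \<comment> \<open>Each application of \<open>?S\<close> adds \<open>s\<close> modulo
    \<open>?L\<close>. For \<open>k = n\<close> the total is a displacement of \<open>?T\<close>, so
    \<open>n * s\<close> lies in \<open>?L\<close>.\<close>
  have "(?S ^^ k) 0 - of_nat k * s \<in> ?L" for k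
  proof (induction k)
    case (Suc k)
    from int_span_add[OF Suc dS[OF unit[of k]]] show ?case by (simp add: algebra_simps)
  qed simp
  from int_span_diff[OF _ this[of n], of "?T 0"] have ns: "of_nat n * s \<in> ?L"
    using iet_diff_int_span[OF d, of 0] by (simp add: n)
  have "\<forall>k\<in>{1..m}. \<exists>b :: real \<Rightarrow> real. Modules.additive b \<and> (\<forall>(z::int) (x::real). b (of_int z * x) = of_int z * b x) \<and>
      (\<forall>i\<in>{1..m}. b (len i) = of_bool (i = k))"
    by (intro ballI lin_indep_dual_functional[OF ind])
  from bchoice[OF this] obtain b :: "nat \<Rightarrow> real \<Rightarrow> real" where b: "\<forall>k\<in>{1..m}. Modules.additive (b k) \<and>
      (\<forall>(z::int) (x::real). b k (of_int z * x) = of_int z * b k x) \<and> (\<forall>i\<in>{1..m}. b k (len i) = of_bool (i = k))"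
    by blast
  then have add: "\<And>k. k \<in> {1..m} \<Longrightarrow> Modules.additive (b k)"
    and scale: "\<And>k (z::int) (x::real). k \<in> {1..m} \<Longrightarrow> b k (of_int z * x) = of_int z * b k x"
    and dual: "\<And>k i. k \<in> {1..m} \<Longrightarrow> i \<in> {1..m} \<Longrightarrow> b k (len i) = of_bool (i = k)"
    by blast+
  have coord: "b k (\<Sum>i=1..m. of_int (z i) * len i) = of_int (z k)" if k: "k \<in> {1..m}" for k z
  proof -
    have "b k (\<Sum>i=1..m. of_int (z i) * len i) = (\<Sum>i=1..m. of_int (z i) * of_bool (i = k))"
      using dual[OF k] by (simp add: Modules.additive.sum[OF add[OF k]] scale[OF k])
    then show ?thesis using k by simp
  qed
  have bint: "\<exists>z. b k x = of_int z" if "k \<in> {1..m}" "x \<in> ?L" for k x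
    using that coord unfolding int_span_def by blast
  \<comment> \<open>As the lengths sum to 1, the number 1 lies in \<open>?L\<close> with every
    coordinate equal to 1.\<close>
  have one: "(\<Sum>i=1..m. of_int 1 * len i) = 1" using d by (simp add: iet_data_def)
  have b1: "b k 1 = 1" if "k \<in> {1..m}" for k using coord[OF that, of "\<lambda>_. 1"] one by simp
  have oneL: "1 \<in> ?L" by (rule int_spanI[where z="\<lambda>_. 1"]) (use one in simp)
  obtain c where c: "of_nat n * s = (\<Sum>i=1..m. of_int (c i) * len i)"
    using ns unfolding int_span_def by blast
  have nat_scale: "b k (of_nat p * x) = of_nat p * b k x" if "k \<in> {1..m}" for k p x
    using scale[OF that, of "int p" x] by simp
  have bs: "of_nat n * b k s = of_int (c k)" if "k \<in> {1..m}" for k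
    using coord[OF that, of c] nat_scale[OF that, of n s] c by simp
  have "\<exists>\<nu>. \<forall>j\<in>{1..m}. int n dvd inversion_sign \<pi> i j - c i - \<nu> * c j" if i: "i \<in> {1..m}" for i
  proof -
    \<comment> \<open>\<open>M\<close> is the group generated by \<open>s\<close> and
      \<open>?L\<close>; it contains every breakpoint of \<open>?S\<close> at which the displacement
      jumps, and all integer multiples of it.\<close>
    define M where "M = {of_int \<nu> * s + w |\<nu> w. w \<in> ?L}"
    have Mdiff: "x - y \<in> M" if xy: "x \<in> M" "y \<in> M" for x y
    proof -
      obtain \<nu> w \<nu>' w' where "x = of_int \<nu> * s + w" "w \<in> ?L" "y = of_int \<nu>' * s + w'" "w' \<in> ?L"
        using xy unfolding M_def by blast
      then have "x - y = of_int (\<nu> - \<nu>') * s + (w - w')" "w - w' \<in> ?L"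
        using int_span_diff by (auto simp: algebra_simps)
      then show ?thesis unfolding M_def by blast
    qed
    have LM: "x \<in> M" if "x \<in> ?L" for x
      unfolding M_def using that by (intro CollectI exI[of _ 0] exI[of _ x]) simp
    have jump: "?g k * (b i (?u (Suc k)) - b i (?u k)) \<in> M" if k: "1 \<le> k" "Suc k \<le> r" for k
    proof -
      from int_span_diff[OF us[of "Suc k"] us[of k]] k have "?u (Suc k) - ?u k \<in> ?L" by simp
      then obtain z where z: "b i (?u (Suc k)) - b i (?u k) = of_int z"
        using bint[OF i] Modules.additive.diff[OF add[OF i]] by metis
      have "?g k < ?g (Suc k)" using k e by (simp add: iet_endpoint_Suc iet_data_def)
      then have "?g k \<in> iet_interval \<mu> (Suc k)" by (simp add: iet_interval_def)
      then have gk: "?g k \<in> {0..<1}" using iet_interval_subset[OF e, of "Suc k"] k by auto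
      show ?thesis
      proof (cases "?g k \<in> ?L \<or> ?S (?g k) \<in> ?L")
        case True
        then consider "?g k \<in> ?L" | "?S (?g k) \<in> ?L" by blast
        then show ?thesis
        proof cases
          case 1
          from LM[OF int_span_mult[OF this, of z]] show ?thesis unfolding z by (simp add: mult.commute)
        next
          case 2
          \<comment> \<open>As \<open>?S\<close> displaces by \<open>s\<close> modulo
            \<open>?L\<close>, the breakpoint lies in \<open>?L - s\<close>.\<close>
          from int_span_mult[OF int_span_diff[OF this dS[OF gk]], of z]
          have "of_int z * (?g k + s) \<in> ?L" by (simp add: algebra_simps)
          moreover have "?g k * of_int z = of_int (- z) * s + of_int z * (?g k + s)"
            by (simp add: algebra_simps)
          ultimately show ?thesis unfolding z M_def by blast
        qed
      next
        case False
        then have "loc_transl ?S (?g k)" using commuting_loc_transl[OF d e min comm gk] by blast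
        then have "?u (Suc k) = ?u k" by (rule iet_shift_Suc_eq[OF e k])
        then show ?thesis using LM by simp
      qed
    qed
    \<comment> \<open>Summation by parts with \<open>\<mu> l = ?g l - ?g (l - 1)\<close>: passing
      from \<open>k\<close> to \<open>Suc k\<close> subtracts exactly the jump term at
      \<open>?g k\<close>.\<close>
    have "(\<Sum>l=1..k. \<mu> l * b i (?u l)) - ?g k * b i (?u k) \<in> M" if "1 \<le> k" "k \<le> r" for k
      using that
    proof (induction k rule: nat_induct_at_least)
      case base
      show ?case using LM by (simp add: iet_endpoint_def)
    next
      case (Suc k)
      then have "(\<Sum>l=1..k. \<mu> l * b i (?u l)) - ?g k * b i (?u k) \<in> M" by simp
      from Mdiff[OF this jump[OF Suc(1) Suc.prems]] show ?case
        by (simp add: iet_endpoint_Suc algebra_simps)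
    qed
    from this[OF r] g1 have "(\<Sum>l=1..r. \<mu> l * b i (?u l)) - b i (?u r) \<in> M" by simp
    then obtain \<nu> w where V: "(\<Sum>l=1..r. \<mu> l * b i (?u l)) = b i (?u r) + of_int \<nu> * s + w"
      and w: "w \<in> ?L" unfolding M_def by (auto simp: algebra_simps)
    obtain q where q: "b i (?u r) = b i s + of_int q"
      using bint[OF i us[of r]] r Modules.additive.diff[OF add[OF i]] by (auto simp: algebra_simps)
    have bt: "b i (?t j) = of_int (inversion_sign \<pi> i j)" if "j \<in> {1..m}" for j
      using coord[OF i] iet_shift_eq[OF that, of \<pi> len] by simp
    have "(\<Sum>j=1..m. of_int (inversion_sign \<pi> i j) * len j) = (\<Sum>j=1..m. len j * b i (?t j))"
      by (rule sum.cong) (simp_all only: bt mult.commute)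
    also have "\<dots> = of_nat n * b i s + (of_int \<nu> * (of_nat n * s) + of_nat n * (of_int q * 1 + w))"
      unfolding sum_shift_iet_power[OF d e n add[OF i]] V q by (simp add: algebra_simps)
    \<comment> \<open>The factor \<open>n\<close> turns \<open>b i s\<close> into the integer
      \<open>c i\<close> and \<open>s\<close> into an element of \<open>?L\<close>.\<close>
    finally have E: "(\<Sum>j=1..m. of_int (inversion_sign \<pi> i j) * len j) =
        of_int (c i) + (of_int \<nu> * (of_nat n * s) + of_nat n * (of_int q * 1 + w))"
      unfolding bs[OF i] .
    have qw: "of_int q * 1 + w \<in> ?L" by (intro int_span_add int_span_mult oneL w)
    have "int n dvd inversion_sign \<pi> i j - c i - \<nu> * c j" if j: "j \<in> {1..m}" for j
    proof -
      obtain z where z: "b j (of_int q * 1 + w) = of_int z" using bint[OF j qw] by blast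
      \<comment> \<open>A second coordinate, now the \<open>j\<close>-th, is applied to the integral
        identity: the constant \<open>c i\<close> contributes \<open>c i\<close>, the multiple of
        \<open>n * s\<close> contributes \<open>\<nu> * c j\<close>, and the rest is divisible by
        \<open>n\<close>.\<close>
      have "of_int (inversion_sign \<pi> i j) =
          b j (of_int (c i) + (of_int \<nu> * (of_nat n * s) + of_nat n * (of_int q * 1 + w)))"
        using coord[OF j, of "inversion_sign \<pi> i"] E by simp
      also have "\<dots> = b j (of_int (c i) * 1) + (of_int \<nu> * (of_nat n * b j s) + of_nat n * of_int z)"
        using z by (simp add: Modules.additive.add[OF add[OF j]] scale[OF j] nat_scale[OF j])
      also have "\<dots> = of_int (c i + \<nu> * c j + int n * z)"
        by (simp only: scale[OF j] b1[OF j] bs[OF j]) simp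
      finally have "inversion_sign \<pi> i j = c i + \<nu> * c j + int n * z"
        using of_int_eq_iff by blast
      then show ?thesis by simp
    qed
    then show ?thesis by blast
  qed
  then show ?thesis by metis
qed

section \<open>From congruences to a rotation\<close>

lemma inversion_sign_cocycle:
  assumes \<pi>: "inj \<pi>" and p: "prime (p::int)"
    and a: "\<And>i j. i \<in> A \<Longrightarrow> j \<in> A \<Longrightarrow> p dvd inversion_sign \<pi> i j - a i - \<nu> i * a j"
    and ijk: "i \<in> A" "j \<in> A" "k \<in> A"
  shows "inversion_sign \<pi> i j + inversion_sign \<pi> j k + inversion_sign \<pi> k i = 0"
proof -
  have anti: "inversion_sign \<pi> j i = - inversion_sign \<pi> i j" for i j
    unfolding inversion_sign_def using injD[OF \<pi>, of i j]
    by (cases i j rule: linorder_cases; cases "\<pi> i" "\<pi> j" rule: linorder_cases) simp_all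
  \<comment> \<open>Going once around three distinct numbers meets one or two ascents, so two such
    counts differ by at most 1.\<close>
  have cyc: "of_bool (x < y) + of_bool (y < z) + of_bool (z < x) \<in> {1, 2 :: int}"
    if "x \<noteq> y" "y \<noteq> z" "z \<noteq> x" for x y z :: nat
    using that by (cases "x < y"; cases "y < z"; cases "z < x") simp_all
  have cong: "p dvd inversion_sign \<pi> i j - (a i - a j)" if ij: "i \<in> A" "j \<in> A" for i j
  proof -
    \<comment> \<open>The diagonal entries vanish, and primality splits the resulting
      product.\<close>
    have diag: "p dvd a i \<or> p dvd 1 + \<nu> i" if "i \<in> A" for i
    proof -
      have "p dvd - (a i * (1 + \<nu> i))" using a[OF that that] by (simp add: inversion_sign_def algebra_simps)
      then show ?thesis using p by (simp add: prime_dvd_mult_iff)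
    qed
    have main: "p dvd inversion_sign \<pi> i j - (a i - a j)" if "i \<in> A" "j \<in> A" "p dvd 1 + \<nu> i" for i j
    proof -
      have "inversion_sign \<pi> i j - (a i - a j) =
          (inversion_sign \<pi> i j - a i - \<nu> i * a j) + (1 + \<nu> i) * a j" by (simp add: algebra_simps)
      then show ?thesis using a[OF that(1,2)] that(3) by (metis dvd_add dvd_mult2)
    qed
    \<comment> \<open>Row \<open>i\<close> or, by antisymmetry, row \<open>j\<close> gives the
      claim; in the last case both sides vanish modulo \<open>p\<close>.\<close>
    consider "p dvd 1 + \<nu> i" | "p dvd 1 + \<nu> j" | "p dvd a i" "p dvd a j"
      using diag ij by blast
    then show ?thesis
    proof cases
      case 1
      then show ?thesis using main ij by blast
    next
      case 2
      have "inversion_sign \<pi> i j - (a i - a j) = - (inversion_sign \<pi> j i - (a j - a i))"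
        using anti[of i j] by simp
      then show ?thesis using main[OF ij(2,1) 2] by (simp only: dvd_minus_iff)
    next
      case 3
      have "inversion_sign \<pi> i j - (a i - a j) =
          (inversion_sign \<pi> i j - a i - \<nu> i * a j) + (\<nu> i * a j + a j)" by simp
      then show ?thesis using a[OF ij] 3 by (metis dvd_add dvd_mult)
    qed
  qed
  let ?Q = "inversion_sign \<pi> i j + inversion_sign \<pi> j k + inversion_sign \<pi> k i"
  have "?Q = (inversion_sign \<pi> i j - (a i - a j)) + (inversion_sign \<pi> j k - (a j - a k))
      + (inversion_sign \<pi> k i - (a k - a i))" by simp
  then have dvd: "p dvd ?Q" using cong ijk by (metis dvd_add)
  have "\<bar>?Q\<bar> \<le> 1"
  proof (cases "i = j \<or> j = k \<or> k = i")
    case True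
    then show ?thesis using anti[of i j] anti[of j k] anti[of k i]
      by (elim disjE) (simp_all add: inversion_sign_def)
  next
    case False
    then have "\<pi> i \<noteq> \<pi> j" "\<pi> j \<noteq> \<pi> k" "\<pi> k \<noteq> \<pi> i" using \<pi> by (auto dest: injD)
    from cyc[OF this] cyc[of i j k] False show ?thesis unfolding inversion_sign_def by auto
  qed
  moreover have "p \<ge> 2" using p prime_ge_2_int by blast
  ultimately show ?thesis using dvd zdvd_imp_le[of p "\<bar>?Q\<bar>"] by fastforce
qed

text \<open>Columns \<open>j\<close> and 1 of the matrix differ by the constant
  \<open>inversion_sign \<pi> 1 j\<close>. As the lengths sum to 1, the two displacements differ by
  that integer.\<close>

lemma rotation_type_if_cocycle:
  assumes d: "iet_data m \<pi> len"
    and c: "\<And>i j k. i \<in> {1..m} \<Longrightarrow> j \<in> {1..m} \<Longrightarrow> k \<in> {1..m} \<Longrightarrow>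
      inversion_sign \<pi> i j + inversion_sign \<pi> j k + inversion_sign \<pi> k i = 0"
  shows "rotation_type (iet m \<pi> len)"
  unfolding rotation_type_def
proof (intro exI ballI)
  let ?t = "iet_shift m \<pi> len"
  fix x :: real assume x: "x \<in> {0..<1}"
  have m: "1 \<in> {1..m}" using d by (simp add: iet_data_def)
  obtain j where j: "j \<in> {1..m}" "x \<in> iet_interval len j" using iet_interval_cases[OF d x] .
  have co: "inversion_sign \<pi> i j = inversion_sign \<pi> i 1 + inversion_sign \<pi> 1 j" if "i \<in> {1..m}" for i
    using c[OF that m j(1)] c[OF that j(1) that] c[OF that that that] by linarith
  have "?t j = (\<Sum>i=1..m. of_int (inversion_sign \<pi> i 1) * len i + of_int (inversion_sign \<pi> 1 j) * len i)"
    unfolding iet_shift_eq[OF j(1)]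
    by (rule sum.cong) (simp_all only: co of_int_add distrib_right)
  also have "\<dots> = ?t 1 + of_int (inversion_sign \<pi> 1 j)"
    using d unfolding iet_shift_eq[OF m] by (simp add: sum.distrib sum_distrib_left[symmetric] iet_data_def)
  finally have "x + ?t 1 - iet m \<pi> len x = of_int (- inversion_sign \<pi> 1 j)"
    using iet_eq_shift[OF d x j] by simp
  then have "x + ?t 1 - iet m \<pi> len x \<in> \<int>" by (metis Ints_of_int)
  then have "frac (x + ?t 1) = iet m \<pi> len x"
    using iet_in_unit[OF d, of x] x by (simp add: frac_unique_iff)
  then show "iet m \<pi> len x = frac (x + ?t 1)" ..
qed

theorem theorem1p3:
  fixes m :: nat and \<pi> :: "nat \<Rightarrow> nat" and len :: "nat \<Rightarrow> real" and T :: "real \<Rightarrow> real"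
  assumes "iet_data m \<pi> len"
    and "T = iet m \<pi> len"
    and "minimal_iet T"
    and "\<not> rotation_type T"
    and "lin_indep_over_rat len {1..m}"
  shows "\<forall>n\<ge>2. \<not> has_iet_root n T"
proof (intro allI impI notI)
  fix n :: nat assume n: "2 \<le> n" and "has_iet_root n T"
  then obtain r \<sigma> \<mu> where e: "iet_data r \<sigma> \<mu>" and T: "iet m \<pi> len = iet r \<sigma> \<mu> ^^ n"
    unfolding has_iet_root_def IETs_def using assms(2) by auto
  obtain a \<nu> where a: "\<And>i j. i \<in> {1..m} \<Longrightarrow> j \<in> {1..m} \<Longrightarrow>
      int n dvd inversion_sign \<pi> i j - a i - \<nu> i * a j"
    using iet_power_inversion_sign_cong[OF assms(1) e assms(3)[unfolded assms(2)] assms(5) T] by metis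
  \<comment> \<open>Passing to a prime factor makes the splitting of products available; one exists
    because \<open>n\<close> is not 1.\<close>
  obtain p where p: "prime p" "p dvd n" using prime_factor_nat[of n] n by auto
  have "prime (int p)" "inj \<pi>"
    using p(1) assms(1) permutes_inj unfolding iet_data_def by auto
  moreover have "int p dvd inversion_sign \<pi> i j - a i - \<nu> i * a j"
    if "i \<in> {1..m}" "j \<in> {1..m}" for i j
    using a[OF that] p(2) by (meson dvd_trans int_dvd_int_iff)
  ultimately have "rotation_type T" unfolding assms(2)
    by (intro rotation_type_if_cocycle[OF assms(1)] inversion_sign_cocycle[where A="{1..m}"])
  with assms(4) show False by contradiction
qed

end
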